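(* In the setting of the context, let $x_0\in\mathbb{R}^{n_x}$, $\boldsymbol{u}\in\mathbb{R}^{n_u(N+1)}$, $\beta\in\mathbb{R}$. If $$\max_{\ell\in\{1,\dots,n_{\mathtt P}\}}\ \min_{k\in\{1,\dots,\mathtt{v}_\ell\}}\ \boldsymbol{\xi}(x_0,\boldsymbol{u})^\top\hat{\boldsymbol{v}}_\ell^{(k)}\ \le\ \eta_N(x_0,\boldsymbol{u},\beta),$$ then $$\max_{\ell\in\{1,\dots,n_{\mathtt P}\}}\ \inf\Big\{\boldsymbol{\gamma}_\ell^\top\boldsymbol{S}_\ell\boldsymbol{\zeta}(x_0,\boldsymbol{u})\ :\ \boldsymbol{\gamma}_\ell\in\mathbb{R}^{2N_c},\ \boldsymbol{\gamma}_\ell\ge0,\ \boldsymbol{B}_{p,N+1}^\top\alpha^\top+(\boldsymbol{S}_\ell\boldsymbol{G})^\top\boldsymbol{\gamma}_\ell=0\Big\}\ \le\ \tilde\beta_N(x_0,\boldsymbol{u},\beta).$$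
   Context: Let $N\ge 0$ and $n_x,n_u,n_c\ge1$ be integers, and $N_c=n_c(N+1)$. For $k=0,\dots,N$ let $A_k\in\mathbb{R}^{n_x\times n_x}$, $B_{u,k}\in\mathbb{R}^{n_x\times n_u}$, $B_{p,k}\in\mathbb{R}^{n_x\times n_c}$, $C_k\in\mathbb{R}^{n_c\times n_x}$, $D_{u,k}\in\mathbb{R}^{n_c\times n_u}$, $D_{p,k}\in\mathbb{R}^{n_c\times n_c}$ be the matrices of the system $x_{k+1}=A_kx_k+B_{u,k}u_k+B_{p,k}\boldsymbol{p}_k$, $\boldsymbol{q}_k=C_kx_k+D_{u,k}u_k+D_{p,k}\boldsymbol{p}_k$, and let $\boldsymbol{u},\boldsymbol{p},\boldsymbol{q}$ be the vectors obtained by stacking $u_k,\boldsymbol{p}_k,\boldsymbol{q}_k$ for $k=0,\dots,N$ (so $\boldsymbol{p},\boldsymbol{q}\in\mathbb{R}^{N_c}$). Stacked matrices. Set $\boldsymbol{A}_0=I$, $\boldsymbol{B}_{u,0}=0$, $\boldsymbol{B}_{p,0}=0$, and for $i=1,\dots,N+1$ let $\boldsymbol{A}_i=A_{i-1}\cdots A_0$; let $\boldsymbol{B}_{u,i}\in\mathbb{R}^{n_x\times n_u(N+1)}$ be the block row whose block number $k$ ($k=0,\dots,N$) is $A_{i-1}\cdots A_{k+1}B_{u,k}$ if $k<i$ (empty product $=I$) and $0$ otherwise; and define $\boldsymbol{B}_{p,i}\in\mathbb{R}^{n_x\times N_c}$ likewise with $B_{p,k}$ in place of $B_{u,k}$.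 Thus $x_i=\boldsymbol{A}_ix_0+\boldsymbol{B}_{u,i}\boldsymbol{u}+\boldsymbol{B}_{p,i}\boldsymbol{p}$. The matrix $\boldsymbol{C}$ has block rows $C_k\boldsymbol{A}_k$; $\boldsymbol{D}_u$ has block rows $C_k\boldsymbol{B}_{u,k}$ plus $D_{u,k}$ added in block column $k$; $\boldsymbol{D}_p\in\mathbb{R}^{N_c\times N_c}$ has block rows $C_k\boldsymbol{B}_{p,k}$ plus $D_{p,k}$ added in block column $k$ ($k=0,\dots,N$). Thus $\boldsymbol{q}=\boldsymbol{C}x_0+\boldsymbol{D}_u\boldsymbol{u}+\boldsymbol{D}_p\boldsymbol{p}$. Channels. Scalar channels are indexed by $c=j+k\,n_c\in\{1,\dots,N_c\}$ with $k\in\{0,\dots,N\}$, $j\in\{1,\dots,n_c\}$. Channel $c$ has a symmetric indefinite multiplier $M_c\in\mathbb{R}^{2\times2}$ with eigenvalues $\lambda_+>0>\lambda_-$ and unit eigenvectors $v_+,v_-$; put $V=\sqrt{\lambda_+}v_+$, $U=\sqrt{|\lambda_-|}v_-$, $g=V+U=[g_q,g_p]^\top$, $h=V-U=[h_q,h_p]^\top$, and $E_c=[g_p,h_p]^\top$, $F_c=[g_q,h_q]^\top\in\mathbb{R}^{2}$. Let $e_c\in\mathbb{R}^{1\times N_c}$ be the $c$-th standard basis row vector. All vector inequalities are componentwise. Let $G_c=F_ce_c\boldsymbol{D}_p+E_ce_c\in\mathbb{R}^{2\times N_c}$ and $\zeta_c(x_0,\boldsymbol{u})=F_ce_c(\boldsymbol{C}x_0+\boldsymbol{D}_u\boldsymbol{u})\in\mathbb{R}^2$;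 let $\boldsymbol{G}\in\mathbb{R}^{2N_c\times N_c}$ and $\boldsymbol{\zeta}(x_0,\boldsymbol{u})\in\mathbb{R}^{2N_c}$ be obtained by stacking $G_c$ and $\zeta_c$ vertically over $c=1,\dots,N_c$. The matrix $\boldsymbol{G}$ has full column rank, so $\dim\ker(\boldsymbol{G}^\top)=N_c$. Let $\boldsymbol{S}_1,\dots,\boldsymbol{S}_{n_{\mathtt P}}$ enumerate the $n_{\mathtt P}=2^{N_c}$ block-diagonal matrices $\mathrm{diag}(I_1,\dots,I_{N_c})\in\mathbb{R}^{2N_c\times2N_c}$ with each $I_c\in\{\mathbb{I}_2,-\mathbb{I}_2\}$, where $\mathbb{I}_2$ is the $2\times2$ identity. State constraint. A single scalar constraint $\alpha x_{N+1}\le\beta$ at final time is considered, with $\alpha\in\mathbb{R}^{1\times n_x}$ fixed and $\beta\in\mathbb{R}$. Put $\tilde\beta_N(x_0,\boldsymbol{u},\beta)=\beta-\alpha(\boldsymbol{A}_{N+1}x_0+\boldsymbol{B}_{u,N+1}\boldsymbol{u})$. Dual parameterization. Let the columns of $\boldsymbol{N}\in\mathbb{R}^{2N_c\times N_c}$ form a basis of $\ker(\boldsymbol{G}^\top)$, and let $\bar{\boldsymbol{\gamma}}=-(\boldsymbol{G}^\top)^\dagger\boldsymbol{B}_{p,N+1}^\top\alpha^\top$, where $\dagger$ is the Moore–Penrose pseudoinverse. For each $\ell$ let $\mathcal{V}_\ell=\{\boldsymbol{v}\in\mathbb{R}^{N_c}:\boldsymbol{S}_\ell\boldsymbol{N}\boldsymbol{v}\ge-\boldsymbol{S}_\ell\bar{\boldsymbol{\gamma}}\}$,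 and let $\hat{\boldsymbol{v}}_\ell^{(1)},\dots,\hat{\boldsymbol{v}}_\ell^{(\mathtt{v}_\ell)}$ be the vertices of the polyhedron $\mathcal{V}_\ell$. Define $\boldsymbol{\xi}(x_0,\boldsymbol{u})=\boldsymbol{N}^\top\boldsymbol{\zeta}(x_0,\boldsymbol{u})\in\mathbb{R}^{N_c}$ and $\eta_N(x_0,\boldsymbol{u},\beta)=\tilde\beta_N(x_0,\boldsymbol{u},\beta)-\boldsymbol{\zeta}(x_0,\boldsymbol{u})^\top\bar{\boldsymbol{\gamma}}$. Infima are taken in the extended reals; the infimum or minimum over an empty set is $+\infty$. *)

theory Defs
  imports "HOL-Analysis.Analysis"
begin

text \<open>
  The horizon is carried by a finite linearly ordered type \<open>'t\<close> with \<open>N + 1\<close> elements; \<open>stage\<close>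
  is its order isomorphism onto \<open>{0..N}\<close>. A vector obtained by stacking blocks indexed by
  \<open>k = 0, \<dots>, N\<close> is indexed by pairs \<open>(t, j)\<close> with \<open>k = stage t\<close> and \<open>j\<close> the position in the block.
  In particular the scalar channels, \<open>c = j + k n\<^sub>c\<close>, are the pairs in \<open>'t \<times> 'c\<close>.
\<close>

definition stage :: "'t::{finite,linorder} \<Rightarrow> nat" where
  "stage t = card {..<t}"

lemma stage_bij: "bij_betw stage (UNIV :: 't::{finite,linorder} set) {..<CARD('t)}"
proof -
  have "strict_mono (stage :: 't \<Rightarrow> nat)"
    unfolding strict_mono_def stage_def
    by (intro allI impI psubset_card_mono finite psubsetI) auto
  then have inj: "inj (stage :: 't \<Rightarrow> nat)"
    by (rule strict_mono_imp_inj_on)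
  have "stage ` (UNIV :: 't set) \<subseteq> {..<CARD('t)}"
    unfolding stage_def by (auto intro!: psubset_card_mono)
  moreover have "card (stage ` (UNIV :: 't set)) = card {..<CARD('t)}"
    using inj by (simp add: card_image)
  ultimately have "stage ` (UNIV :: 't set) = {..<CARD('t)}"
    by (intro card_subset_eq) auto
  with inj show ?thesis by (simp add: bij_betw_def)
qed

text \<open>\<open>transition A k i\<close> is the product \<open>A\<^sub>i\<^sub>-\<^sub>1 \<cdots> A\<^sub>k\<close>, the identity if \<open>i \<le> k\<close>.\<close>

fun transition :: "(nat \<Rightarrow> real^'x^'x) \<Rightarrow> nat \<Rightarrow> nat \<Rightarrow> real^'x^'x" where
  "transition A k 0 = mat 1"
| "transition A k (Suc i) = (if k \<le> i then A i ** transition A k i else mat 1)"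

definition stacked_A :: "(nat \<Rightarrow> real^'x^'x) \<Rightarrow> nat \<Rightarrow> real^'x^'x" where
  "stacked_A A i = transition A 0 i"

definition stacked_B ::
    "(nat \<Rightarrow> real^'x^'x) \<Rightarrow> (nat \<Rightarrow> real^'b^'x) \<Rightarrow> nat \<Rightarrow> real^('t::{finite,linorder} \<times> 'b)^'x" where
  "stacked_B A B i = (\<chi> r s. let k = stage (fst s) in
     if k < i then (transition A (k + 1) i ** B k) $ r $ snd s else 0)"

definition stacked_C ::
    "(nat \<Rightarrow> real^'x^'x) \<Rightarrow> (nat \<Rightarrow> real^'x^'c) \<Rightarrow> real^'x^('t::{finite,linorder} \<times> 'c)" where
  "stacked_C A C = (\<chi> r. (C (stage (fst r)) ** stacked_A A (stage (fst r))) $ snd r)"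

definition stacked_D ::
    "(nat \<Rightarrow> real^'x^'x) \<Rightarrow> (nat \<Rightarrow> real^'b^'x) \<Rightarrow> (nat \<Rightarrow> real^'x^'c) \<Rightarrow> (nat \<Rightarrow> real^'b^'c)
      \<Rightarrow> real^('t \<times> 'b)^('t::{finite,linorder} \<times> 'c)" where
  "stacked_D A B C D = (\<chi> r s. let k = stage (fst r) in
     (C k ** (stacked_B A B k :: real^('t \<times> 'b)^'x)) $ snd r $ s
     + (if fst s = fst r then D k $ snd r $ snd s else 0))"

lemma stacked_state:
  fixes A :: "nat \<Rightarrow> real^'x^'x"
    and Bu :: "nat \<Rightarrow> real^'u^'x" and Bp :: "nat \<Rightarrow> real^'c^'x"
    and u :: "real^('t::{finite,linorder} \<times> 'u)" and p :: "real^('t \<times> 'c)" and x :: "nat \<Rightarrow> real^'x"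
  assumes dyn: "\<And>t::'t. x (stage t + 1) = A (stage t) *v x (stage t)
      + Bu (stage t) *v (\<chi> j. u $ (t, j)) + Bp (stage t) *v (\<chi> j. p $ (t, j))"
    and "i \<le> CARD('t)"
  shows "x i = stacked_A A i *v x 0 + stacked_B A Bu i *v u + stacked_B A Bp i *v p"
  using assms(2)
proof (induction i)
  case 0
  show ?case
    by (simp add: stacked_A_def stacked_B_def Let_def vec_eq_iff matrix_vector_mult_def mat_def
        if_distrib[of "\<lambda>a. a * _"] cong: if_cong)
next
  case (Suc i)
  have "i \<in> stage ` (UNIV :: 't set)"
    using stage_bij[where 't = 't] Suc.prems by (simp add: bij_betw_def)
  then obtain t0 :: 't where t0: "stage t0 = i" by auto
  have st_eq: "stage t = i \<longleftrightarrow> t = t0" for t :: 't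
    using stage_bij[where 't = 't] t0 unfolding bij_betw_def inj_def by auto
  have tr: "transition A i i = mat 1" for i by (cases i) auto
  have step: "stacked_B A B (Suc i) *v w = A i *v (stacked_B A B i *v w) + B i *v (\<chi> j. w $ (t0, j))"
    for B :: "nat \<Rightarrow> real^'b^'x" and w :: "real^('t \<times> 'b)"
  proof -
    have ent: "(stacked_B A B (Suc i) :: real^('t \<times> 'b)^'x) $ r $ s
        = (A i ** stacked_B A B i) $ r $ s + (if fst s = t0 then B i $ r $ snd s else 0)" for r s
    proof -
      consider "stage (fst s) < i" | "fst s = t0" | "stage (fst s) > i"
        using st_eq[of "fst s"] by linarith
      then show ?thesis
      proof cases
        case 1
        then have ne: "fst s \<noteq> t0" using t0 by auto
        let ?k = "stage (fst s)"
        have "transition A (?k + 1) (Suc i) ** B ?k = A i ** (transition A (?k + 1) i ** B ?k)"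
          using 1 by (simp add: matrix_mul_assoc)
        then show ?thesis
          using 1 ne by (simp add: stacked_B_def Let_def matrix_matrix_mult_def[of "A i"])
      next
        case 2
        then show ?thesis by (simp add: stacked_B_def Let_def t0 tr matrix_matrix_mult_def[of "A i"])
      next
        case 3
        then show ?thesis using t0 by (auto simp: stacked_B_def Let_def matrix_matrix_mult_def[of "A i"])
      qed
    qed
    have "(\<Sum>s\<in>UNIV. (if fst s = t0 then B i $ r $ snd s else 0) * w $ s)
        = (\<Sum>j\<in>UNIV. B i $ r $ j * w $ (t0, j))" for r
    proof -
      have "(\<Sum>s\<in>UNIV. (if fst s = t0 then B i $ r $ snd s else 0) * w $ s)
        = (\<Sum>s\<in>UNIV \<times> UNIV. (case s of (t, j) \<Rightarrow> (if t = t0 then B i $ r $ j * w $ (t, j) else 0)))"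
        by (intro sum.cong) auto
      also have "\<dots> = (\<Sum>t\<in>UNIV. \<Sum>j\<in>UNIV. if t = t0 then B i $ r $ j * w $ (t, j) else 0)"
        by (simp only: sum.cartesian_product)
      also have "\<dots> = (\<Sum>t\<in>UNIV. if t = t0 then (\<Sum>j\<in>UNIV. B i $ r $ j * w $ (t, j)) else 0)"
        by (intro sum.cong) auto
      finally show ?thesis by simp
    qed
    then show ?thesis
      unfolding matrix_vector_mul_assoc
      by (simp add: vec_eq_iff matrix_vector_mult_def[of _ w] matrix_vector_mult_def[of "B i"] ent
          distrib_right sum.distrib)
  qed
  have "x (Suc i) = A i *v x i + Bu i *v (\<chi> j. u $ (t0, j)) + Bp i *v (\<chi> j. p $ (t0, j))"
    using dyn[of t0] t0 by simp
  also have "\<dots> = stacked_A A (Suc i) *v x 0 + stacked_B A Bu (Suc i) *v u + stacked_B A Bp (Suc i) *v p"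
    using Suc by (simp add: step stacked_A_def matrix_vector_right_distrib matrix_vector_mul_assoc)
  finally show ?case .
qed

text \<open>In \<open>real^2\<close>, component \<open>1\<close> belongs to \<open>q\<close> and component \<open>2\<close> to \<open>p\<close>.\<close>

definition multiplier_g :: "real \<Rightarrow> real \<Rightarrow> real^2 \<Rightarrow> real^2 \<Rightarrow> real^2" where
  "multiplier_g l_pos l_neg v_pos v_neg = sqrt l_pos *\<^sub>R v_pos + sqrt \<bar>l_neg\<bar> *\<^sub>R v_neg"

definition multiplier_h :: "real \<Rightarrow> real \<Rightarrow> real^2 \<Rightarrow> real^2 \<Rightarrow> real^2" where
  "multiplier_h l_pos l_neg v_pos v_neg = sqrt l_pos *\<^sub>R v_pos - sqrt \<bar>l_neg\<bar> *\<^sub>R v_neg"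

text \<open>Vertical stacking of the \<open>2 \<times> n\<close> blocks \<open>F\<^sub>c e\<^sub>c D\<^sub>p + E\<^sub>c e\<^sub>c\<close>, respectively of the
  vectors \<open>F\<^sub>c e\<^sub>c w\<close> with \<open>w = C x\<^sub>0 + D\<^sub>u u\<close>, over all channels \<open>c\<close>.\<close>

definition stacked_G :: "('n \<Rightarrow> real^2) \<Rightarrow> ('n \<Rightarrow> real^2) \<Rightarrow> real^'n^'n \<Rightarrow> real^'n^('n::finite \<times> 2)" where
  "stacked_G E F Dp = (\<chi> r. let c = fst r; i = snd r in
     (F c $ i) *\<^sub>R row c Dp + (E c $ i) *\<^sub>R axis c 1)"

definition stacked_zeta :: "('n \<Rightarrow> real^2) \<Rightarrow> real^'n \<Rightarrow> real^('n::finite \<times> 2)" where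
  "stacked_zeta F w = (\<chi> r. let c = fst r; i = snd r in F c $ i * w $ c)"

definition block_diag :: "('n \<Rightarrow> real^2^2) \<Rightarrow> real^('n \<times> 2)^('n::finite \<times> 2)" where
  "block_diag I = (\<chi> r s. if fst r = fst s then I (fst r) $ snd r $ snd s else 0)"

definition sign_matrices :: "(real^('n \<times> 2)^('n::finite \<times> 2)) set" where
  "sign_matrices = {block_diag I | I. \<forall>c. I c = mat 1 \<or> I c = - mat 1}"

definition is_moore_penrose :: "real^'n^'m \<Rightarrow> real^'m^'n \<Rightarrow> bool" where
  "is_moore_penrose A X \<longleftrightarrow>
     A ** X ** A = A \<and> X ** A ** X = X \<and>
     transpose (A ** X) = A ** X \<and> transpose (X ** A) = X ** A"

definition moore_penrose :: "real^'n^'m \<Rightarrow> real^'m^'n" where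
  "moore_penrose A = (THE X. is_moore_penrose A X)"

lemma is_moore_penrose_unique:
  assumes "is_moore_penrose A X" "is_moore_penrose A Y"
  shows "X = Y"
proof -
  note X = assms(1)[unfolded is_moore_penrose_def] and Y = assms(2)[unfolded is_moore_penrose_def]
  have AXY: "A ** X = A ** Y"
    by (metis X Y matrix_mul_assoc matrix_transpose_mul)
  have XYA: "X ** A = Y ** A"
    by (metis X Y matrix_mul_assoc matrix_transpose_mul)
  show ?thesis
    by (metis X Y AXY XYA matrix_mul_assoc)
qed

definition columns_basis_of :: "real^'k^'m \<Rightarrow> (real^'m) set \<Rightarrow> bool" where
  "columns_basis_of B W \<longleftrightarrow>
     inj (\<lambda>j. column j B) \<and> independent (columns B) \<and> span (columns B) = W"

definition vertices :: "'a::real_vector set \<Rightarrow> 'a set" where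
  "vertices P = {v. v extreme_point_of P}"

end

theory Submission
  imports Defs
begin

text \<open>
  For each sign pattern \<open>l\<close> the polyhedron \<open>V l\<close> parameterizes the feasible set of the \<open>l\<close>-th dual
  program through the substitution \<open>\<gamma> = S l (\<gamma>bar + NN v)\<close>. Because \<open>S l\<close> is symmetric with square
  \<open>1\<close>, it drops out of the equality constraint and of the objective: writing \<open>b\<close> for \<open>Bp_end\<^sup>T \<alpha>\<close>,
  the constraint becomes \<open>b + G\<^sup>T \<gamma>bar + G\<^sup>T NN v = 0\<close> and the objective \<open>\<zeta> \<bullet> \<gamma>bar + \<xi> \<bullet> v\<close>, whereas
  \<open>\<gamma> \<ge> 0\<close> is the inequality that defines \<open>V l\<close>. Thus every vertex of \<open>V l\<close> provides a dual feasible
  point, whose value differs from the vertex value by the constant \<open>\<zeta> \<bullet> \<gamma>bar = \<beta>tilde - \<eta>\<close>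
  (\<open>dual_value_le_if_vertex_value_le\<close>). When \<open>V l\<close> has no vertex, the infimum is \<open>\<infinity>\<close> and the
  criterion fails.

  The term \<open>G\<^sup>T NN v\<close> vanishes by the choice of \<open>NN\<close>. That \<open>G\<^sup>T \<gamma>bar = - b\<close> requires the
  pseudoinverse of \<open>G\<^sup>T\<close> to be a right inverse (\<open>moore_penrose_right_inverse\<close>), hence \<open>G\<close> to be
  injective. This is where the multipliers matter (\<open>stacked_G_mult_eq_0D\<close>): \<open>G w = 0\<close> says that for
  each channel \<open>c\<close> the pair \<open>((D\<^sub>p w)\<^sub>c, w\<^sub>c)\<close> is orthogonal to \<open>g\<close> and \<open>h\<close>, so to both eigenvectors
  of \<open>M c\<close>, which form an orthogonal basis of the plane; therefore \<open>w\<^sub>c = 0\<close>.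
\<close>

section \<open>The pseudoinverse of a matrix with independent rows\<close>

text \<open>The Gram matrix \<open>A A\<^sup>T\<close> is invertible, so that \<open>A\<^sup>T (A A\<^sup>T)\<^sup>-\<^sup>1\<close> makes sense; it satisfies the
  four Penrose equations and is a right inverse.\<close>

lemma moore_penrose_right_inverse:
  fixes A :: "real^'n^'m"
  assumes inj: "\<And>w. transpose A *v w = 0 \<Longrightarrow> w = 0"
  shows "A ** moore_penrose A = mat 1"
proof -
  define K where "K = A ** transpose A"
  have "w = 0" if "K *v w = 0" for w
  proof -
    have "(transpose A *v w) \<bullet> (transpose A *v w) = w \<bullet> (K *v w)"
      by (simp add: K_def transpose_matrix_vector dot_lmul_matrix flip: matrix_vector_mul_assoc)
    then show ?thesis using that inj by simp
  qed
  then obtain L where LK: "L ** K = mat 1"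
    using matrix_left_invertible_ker by blast
  then have KL: "K ** L = mat 1" by (simp add: matrix_left_right_inverse)
  have K_sym: "transpose K = K" by (simp add: K_def matrix_transpose_mul)
  have "transpose L ** K = mat 1"
    using KL K_sym by (metis matrix_transpose_mul transpose_mat)
  then have L_sym: "transpose L = L"
    using KL by (metis matrix_mul_assoc matrix_mul_lid matrix_mul_rid)
  let ?X = "transpose A ** L"
  have AX: "A ** ?X = mat 1" using KL by (simp add: K_def matrix_mul_assoc)
  have "transpose (?X ** A) = ?X ** A"
    by (simp add: matrix_transpose_mul L_sym matrix_mul_assoc)
  moreover have "?X ** A ** ?X = ?X"
    using AX by (metis matrix_mul_assoc matrix_mul_rid)
  ultimately have "is_moore_penrose A ?X"
    using AX by (simp add: is_moore_penrose_def transpose_mat)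
  then have "moore_penrose A = ?X"
    unfolding moore_penrose_def by (blast intro: is_moore_penrose_unique)
  with AX show ?thesis by simp
qed

section \<open>Injectivity of the stacked multiplier matrix\<close>

lemma symmetric_eigenvectors_orthogonal:
  fixes M :: "real^'n^'n"
  assumes "transpose M = M" "M *v v = a *\<^sub>R v" "M *v w = b *\<^sub>R w" "a \<noteq> b"
  shows "v \<bullet> w = 0"
proof -
  have "(M *v v) \<bullet> w = v \<bullet> (M *v w)"
    using assms(1) by (metis dot_lmul_matrix transpose_matrix_vector)
  then show ?thesis using assms by simp
qed

lemma eq_0_if_orthogonal_to_orthogonal_pair:
  fixes v w z :: "real^2"
  assumes "v \<noteq> 0" "w \<noteq> 0" "v \<bullet> w = 0" "z \<bullet> v = 0" "z \<bullet> w = 0"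
  shows "z = 0"
proof (rule ccontr)
  assume z: "z \<noteq> 0"
  have "pairwise orthogonal {v, w, z}"
    using assms by (auto simp: pairwise_def orthogonal_def inner_commute)
  then have "independent {v, w, z}"
    using assms z by (intro pairwise_orthogonal_independent) auto
  then have "card {v, w, z} \<le> 2"
    using independent_bound by force
  moreover have "v \<noteq> w" "v \<noteq> z" "w \<noteq> z"
    using assms z by auto
  ultimately show False by simp
qed

text \<open>The sum and the difference of \<open>g\<close> and \<open>h\<close> are positive multiples of the two eigenvectors.\<close>

lemma eq_0_if_orthogonal_to_multiplier_factors:
  fixes M :: "real^2^2"
  assumes "transpose M = M"
    and "l_pos > 0" "norm v_pos = 1" "M *v v_pos = l_pos *\<^sub>R v_pos"
    and "l_neg < 0" "norm v_neg = 1" "M *v v_neg = l_neg *\<^sub>R v_neg"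
    and g: "z \<bullet> multiplier_g l_pos l_neg v_pos v_neg = 0"
    and h: "z \<bullet> multiplier_h l_pos l_neg v_pos v_neg = 0"
  shows "z = 0"
proof (rule eq_0_if_orthogonal_to_orthogonal_pair)
  show "v_pos \<noteq> 0" "v_neg \<noteq> 0" using assms by auto
  show "v_pos \<bullet> v_neg = 0"
    using assms by (intro symmetric_eigenvectors_orthogonal[of M _ l_pos _ l_neg]) auto
  have "sqrt l_pos * (z \<bullet> v_pos) + sqrt \<bar>l_neg\<bar> * (z \<bullet> v_neg) = 0"
    using g by (simp add: multiplier_g_def inner_add_right)
  moreover have "sqrt l_pos * (z \<bullet> v_pos) - sqrt \<bar>l_neg\<bar> * (z \<bullet> v_neg) = 0"
    using h by (simp add: multiplier_h_def inner_diff_right)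
  ultimately have "sqrt l_pos * (z \<bullet> v_pos) = 0" "sqrt \<bar>l_neg\<bar> * (z \<bullet> v_neg) = 0"
    by linarith+
  then show "z \<bullet> v_pos = 0" "z \<bullet> v_neg = 0" using assms by auto
qed

lemma stacked_G_mult_nth:
  "(stacked_G E F D *v w) $ (c, i) = F c $ i * (D *v w) $ c + E c $ i * w $ c"
proof -
  have "(stacked_G E F D *v w) $ (c, i)
      = F c $ i * (row c D \<bullet> w) + E c $ i * (axis c 1 \<bullet> w)"
    by (simp add: matrix_vector_mult_def stacked_G_def inner_vec_def row_def sum_distrib_left
        distrib_right sum.distrib mult.assoc)
  then show ?thesis
    by (simp add: inner_axis' matrix_vector_mul_component row_def)
qed

text \<open>Block \<open>c\<close> of \<open>G w\<close> is the \<open>2 \<times> 2\<close> matrix with columns \<open>F c\<close> and \<open>E c\<close> applied to the pair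
  \<open>((D w)\<^sub>c, w\<^sub>c)\<close>, so injectivity of these small matrices suffices, whatever the coupling \<open>D\<close>.\<close>

lemma stacked_G_mult_eq_0D:
  assumes rows: "\<And>c z :: real^2. \<lbrakk>\<And>i. F c $ i * z $ 1 + E c $ i * z $ 2 = 0\<rbrakk> \<Longrightarrow> z = 0"
    and "stacked_G E F D *v w = 0"
  shows "w = 0"
proof -
  have "(vector [(D *v w) $ c, w $ c] :: real^2) = 0" for c
    using assms(2) by (intro rows[of c]) (simp add: flip: stacked_G_mult_nth)
  then have "w $ c = 0" for c
    by (metis vector_2(2) zero_index)
  then show ?thesis by (simp add: vec_eq_iff)
qed

section \<open>The dual parameterization\<close>

lemma sign_matrix_is_diagonal:
  fixes S :: "real^('n::finite \<times> 2)^('n \<times> 2)"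
  assumes "S \<in> sign_matrices"
  obtains s where "\<And>r. s r = 1 \<or> s r = (-1::real)" "S = (\<chi> r r'. if r = r' then s r else 0)"
proof -
  obtain I where I: "S = block_diag I" "\<forall>c. I c = mat 1 \<or> I c = - mat 1"
    using assms unfolding sign_matrices_def by blast
  define s where "s r = I (fst r) $ 1 $ 1" for r :: "'n \<times> 2"
  have I_nth: "I c $ i $ j = (if i = j then I c $ 1 $ 1 else 0)" for c and i j :: 2
    using I(2)[rule_format, of c] by (auto simp: mat_def)
  show ?thesis
  proof
    show "s r = 1 \<or> s r = - 1" for r
      using I(2)[rule_format, of "fst r"] by (auto simp: s_def mat_def)
    show "S = (\<chi> r r'. if r = r' then s r else 0)"
      unfolding I(1) block_diag_def s_def vec_eq_iff vec_lambda_beta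
      by (subst I_nth) (simp add: prod_eq_iff)
  qed
qed

lemma sign_matrix_symmetric:
  "S \<in> sign_matrices \<Longrightarrow> transpose S = S"
  by (erule sign_matrix_is_diagonal) (auto simp: vec_eq_iff transpose_def)

lemma sign_matrix_involution:
  fixes S :: "real^('n::finite \<times> 2)^('n \<times> 2)"
  assumes "S \<in> sign_matrices"
  shows "S ** S = mat 1"
proof -
  obtain s where s: "\<And>r. s r = 1 \<or> s r = (-1::real)" "S = (\<chi> r r'. if r = r' then s r else 0)"
    using sign_matrix_is_diagonal[OF assms] by blast
  have sq: "s r * s r = 1" for r using s(1)[of r] by auto
  have "(S ** S) $ r $ r' = (mat 1 :: real^('n \<times> 2)^('n \<times> 2)) $ r $ r'" for r r'
  proof -
    have "(S ** S) $ r $ r' = (\<Sum>k\<in>UNIV. if k = r then (if r = r' then s r * s r else 0) else 0)"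
      unfolding matrix_matrix_mult_def s(2) vec_lambda_beta by (rule sum.cong) auto
    also have "\<dots> = (if r = r' then 1 else 0)"
      by (simp only: sq sum.delta finite_class.finite_UNIV UNIV_I if_True)
    finally show ?thesis by (simp only: mat_def vec_lambda_beta)
  qed
  then show ?thesis by (simp add: vec_eq_iff)
qed

text \<open>The affine map \<open>v \<mapsto> S (\<gamma> + N v)\<close> carries the polyhedron, and
  in particular its vertices, into the dual feasible set, and shifts the objective by \<open>\<zeta> \<bullet> \<gamma>\<close>.
  The infima are compared pointwise, which also covers the value \<open>\<infinity>\<close> of an empty infimum.\<close>

lemma dual_value_le_if_vertex_value_le:
  fixes G :: "real^'n^('n \<times> 2)" and NN :: "real^'k^('n \<times> 2)"
  assumes S: "S \<in> sign_matrices"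
    and NN: "\<And>v. transpose G *v (NN *v v) = 0"
    and \<gamma>: "b + transpose G *v \<gamma> = 0"
    and le: "(INF v\<in>vertices {v. (S ** NN) *v v \<ge> - (S *v \<gamma>)}. ereal ((transpose NN *v \<zeta>) \<bullet> v))
        \<le> ereal (\<beta> - \<zeta> \<bullet> \<gamma>)"
  shows "(INF y\<in>{y. y \<ge> 0 \<and> b + transpose (S ** G) *v y = 0}. ereal (y \<bullet> (S *v \<zeta>))) \<le> ereal \<beta>"
    (is "?I \<le> _")
proof -
  have SS: "S *v (S *v y) = y" for y
    using sign_matrix_involution[OF S] by (simp add: matrix_vector_mul_assoc)
  have S_adj: "(S *v y) \<bullet> z = y \<bullet> (S *v z)" for y z
    using sign_matrix_symmetric[OF S] by (metis dot_lmul_matrix transpose_matrix_vector)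
  have bound: "?I \<le> ereal ((transpose NN *v \<zeta>) \<bullet> v + \<zeta> \<bullet> \<gamma>)"
    if v: "(S ** NN) *v v \<ge> - (S *v \<gamma>)" for v
  proof -
    let ?y = "S *v (\<gamma> + NN *v v)"
    have "?y \<ge> 0"
      using v by (simp add: less_eq_vec_def matrix_vector_right_distrib matrix_vector_mul_assoc)
        (smt (verit))
    moreover have "transpose (S ** G) *v ?y = transpose G *v (\<gamma> + NN *v v)"
      by (simp add: matrix_transpose_mul sign_matrix_symmetric[OF S] SS flip: matrix_vector_mul_assoc)
    then have "b + transpose (S ** G) *v ?y = 0"
      using \<gamma> NN by (simp add: matrix_vector_right_distrib)
    ultimately have "?I \<le> ereal (?y \<bullet> (S *v \<zeta>))"
      by (intro INF_lower) simp
    also have "?y \<bullet> (S *v \<zeta>) = (\<gamma> + NN *v v) \<bullet> \<zeta>"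
      by (simp add: S_adj SS)
    also have "\<dots> = (transpose NN *v \<zeta>) \<bullet> v + \<zeta> \<bullet> \<gamma>"
      by (simp add: inner_add_right dot_lmul_matrix inner_commute[of _ \<zeta>])
    finally show ?thesis .
  qed
  have "?I - ereal (\<zeta> \<bullet> \<gamma>) \<le> (INF v\<in>vertices {v. (S ** NN) *v v \<ge> - (S *v \<gamma>)}.
      ereal ((transpose NN *v \<zeta>) \<bullet> v))"
  proof (rule INF_greatest)
    fix v assume "v \<in> vertices {v. (S ** NN) *v v \<ge> - (S *v \<gamma>)}"
    then have "?I \<le> ereal ((transpose NN *v \<zeta>) \<bullet> v + \<zeta> \<bullet> \<gamma>)"
      by (intro bound) (auto simp: vertices_def extreme_point_of_def)
    then show "?I - ereal (\<zeta> \<bullet> \<gamma>) \<le> ereal ((transpose NN *v \<zeta>) \<bullet> v)"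
      by (simp add: ereal_minus_le)
  qed
  also note le
  finally show ?thesis
    by (simp add: ereal_minus_le)
qed

theorem mainTheorem5:
  fixes N :: nat
    and A :: "nat \<Rightarrow> real^'x^'x"
    and Bu :: "nat \<Rightarrow> real^'u^'x" and Bp :: "nat \<Rightarrow> real^'c^'x"
    and C :: "nat \<Rightarrow> real^'x^'c"
    and Du :: "nat \<Rightarrow> real^'u^'c" and Dp :: "nat \<Rightarrow> real^'c^'c"
    and M :: "'t::{finite,linorder} \<times> 'c \<Rightarrow> real^2^2"
    and l_pos l_neg :: "'t \<times> 'c \<Rightarrow> real"
    and v_pos v_neg E F :: "'t \<times> 'c \<Rightarrow> real^2"
    and G :: "real^('t \<times> 'c)^(('t \<times> 'c) \<times> 2)"
    and S :: "nat \<Rightarrow> real^(('t \<times> 'c) \<times> 2)^(('t \<times> 'c) \<times> 2)"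
    and NN :: "real^('t \<times> 'c)^(('t \<times> 'c) \<times> 2)"
    and \<alpha> x0 :: "real^'x" and u :: "real^('t \<times> 'u)"
    and Bp_end :: "real^('t \<times> 'c)^'x"
    and \<zeta> \<gamma>bar :: "real^(('t \<times> 'c) \<times> 2)"
    and \<xi> :: "real^('t \<times> 'c)"
    and V :: "nat \<Rightarrow> (real^('t \<times> 'c)) set"
    and \<beta> \<beta>tilde \<eta> :: real and nP :: nat
  assumes horizon: "CARD('t) = N + 1"
    and M_sym: "\<And>c. transpose (M c) = M c"
    and eig_pos: "\<And>c. l_pos c > 0 \<and> norm (v_pos c) = 1 \<and> M c *v v_pos c = l_pos c *\<^sub>R v_pos c"
    and eig_neg: "\<And>c. l_neg c < 0 \<and> norm (v_neg c) = 1 \<and> M c *v v_neg c = l_neg c *\<^sub>R v_neg c"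
    and E: "\<And>c. E c = vector [multiplier_g (l_pos c) (l_neg c) (v_pos c) (v_neg c) $ 2,
                               multiplier_h (l_pos c) (l_neg c) (v_pos c) (v_neg c) $ 2]"
    and F: "\<And>c. F c = vector [multiplier_g (l_pos c) (l_neg c) (v_pos c) (v_neg c) $ 1,
                               multiplier_h (l_pos c) (l_neg c) (v_pos c) (v_neg c) $ 1]"
    and G: "G = stacked_G E F (stacked_D A Bp C Dp)"
    and \<zeta>: "\<zeta> = stacked_zeta F (stacked_C A C *v x0 + stacked_D A Bu C Du *v u)"
    and nP: "nP = 2 ^ CARD('t \<times> 'c)"
    and S: "bij_betw S {1..nP} sign_matrices"
    and Bp_end: "Bp_end = stacked_B A Bp (N + 1)"
    and \<beta>tilde: "\<beta>tilde = \<beta> - \<alpha> \<bullet> (stacked_A A (N + 1) *v x0 + stacked_B A Bu (N + 1) *v u)"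
    and NN: "columns_basis_of NN {w. transpose G *v w = 0}"
    and \<gamma>bar: "\<gamma>bar = - (moore_penrose (transpose G) *v (transpose Bp_end *v \<alpha>))"
    and V: "\<And>l. V l = {v. (S l ** NN) *v v \<ge> - (S l *v \<gamma>bar)}"
    and \<xi>: "\<xi> = transpose NN *v \<zeta>"
    and \<eta>: "\<eta> = \<beta>tilde - \<zeta> \<bullet> \<gamma>bar"
    and criterion: "(MAX l\<in>{1..nP}. INF v\<in>vertices (V l). ereal (\<xi> \<bullet> v)) \<le> ereal \<eta>"
  shows "(MAX l\<in>{1..nP}. INF \<gamma>\<in>{\<gamma>. \<gamma> \<ge> 0 \<and> transpose Bp_end *v \<alpha> + transpose (S l ** G) *v \<gamma> = 0}.
            ereal (\<gamma> \<bullet> (S l *v \<zeta>))) \<le> ereal \<beta>tilde"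
proof -
  have "w = 0" if "G *v w = 0" for w
  proof (rule stacked_G_mult_eq_0D)
    show "stacked_G E F (stacked_D A Bp C Dp) *v w = 0" using that G by simp
    fix c and z :: "real^2" assume z: "\<And>i. F c $ i * z $ 1 + E c $ i * z $ 2 = 0"
    from z[of 1] z[of 2] show "z = 0"
      using M_sym eig_pos eig_neg
      by (intro eq_0_if_orthogonal_to_multiplier_factors
            [of "M c" "l_pos c" "v_pos c" "l_neg c" "v_neg c"])
        (simp_all add: E F inner_vec_def sum_2 mult.commute)
  qed
  then have "transpose G ** moore_penrose (transpose G) = mat 1"
    by (intro moore_penrose_right_inverse) simp
  then have \<gamma>bar_eq: "transpose Bp_end *v \<alpha> + transpose G *v \<gamma>bar = 0"
    unfolding \<gamma>bar linear_neg[OF matrix_vector_mul_linear]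
      matrix_vector_mul_assoc[of "transpose G" "moore_penrose (transpose G)"]
    by (simp only: matrix_vector_mul_lid add.right_inverse)
  have NN_ker: "transpose G *v (NN *v v) = 0" for v
  proof -
    have "NN *v v \<in> span (columns NN)"
      by (rule matrix_vector_mult_in_columnspace)
    then show ?thesis using NN by (simp add: columns_basis_of_def)
  qed
  have "(INF \<gamma>\<in>{\<gamma>. \<gamma> \<ge> 0 \<and> transpose Bp_end *v \<alpha> + transpose (S l ** G) *v \<gamma> = 0}.
      ereal (\<gamma> \<bullet> (S l *v \<zeta>))) \<le> ereal \<beta>tilde" if l: "l \<in> {1..nP}" for l
  proof (rule dual_value_le_if_vertex_value_le[OF _ NN_ker \<gamma>bar_eq])
    show "S l \<in> sign_matrices" using S l by (rule bij_betwE[THEN bspec])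
    have "(INF v\<in>vertices (V l). ereal (\<xi> \<bullet> v)) \<le> ereal \<eta>"
      using criterion l by (subst (asm) Max_le_iff) auto
    then show "(INF v\<in>vertices {v. (S l ** NN) *v v \<ge> - (S l *v \<gamma>bar)}.
        ereal ((transpose NN *v \<zeta>) \<bullet> v)) \<le> ereal (\<beta>tilde - \<zeta> \<bullet> \<gamma>bar)"
      by (simp add: V \<xi> \<eta>)
  qed
  moreover have "{1..nP} \<noteq> {}" by (simp add: nP)
  ultimately show ?thesis by (subst Max_le_iff) auto
qed

end
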